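(* Let $f:[x^{\text{left}},x^{\text{right}}]\to\mathbb{R}$ be convex, let $f'(x)$ denote a (sub)gradient of $f$ at $x$ for each $x$, and let $y^{\text{tol}}\ge 0$. Run the $\Delta$-Bisection algorithm (described in the context) on $f$ with tolerance $y^{\text{tol}}$. Let $t\ge 2$ be such that the algorithm reaches iteration $t+1$ and $|\Delta^y_{t+1}|>y^{\text{tol}}$. Then $$\frac{|\Delta^x_{t+1}|}{|\Delta^x_t|}=\frac12\cdot\frac{y^{\text{low}}_{t+1}-z_t}{\max\{y^q_t,\,y^{\text{low}}_t\}-z_t}\;\le\;\frac12,\qquad z_t=f^{\text{high}}_{t+1}(x^{\text{low}}_{t+1}),$$ where $f^{\text{high}}_{t+1}(x)=f(x^{\text{high}}_{t+1})+(x-x^{\text{high}}_{t+1})f'(x^{\text{high}}_{t+1})$ is the tangent of $f$ at $x^{\text{high}}_{t+1}$.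
   Context: The $\Delta$-Bisection algorithm. At each iteration $t=1,2,\dots$ it maintains two abscissae $x^0_t\le x^1_t$, with $y^0_t=f(x^0_t)$ and $y^1_t=f(x^1_t)$, together with $f'(x^0_t)$ and $f'(x^1_t)$. Initially $x^0_1=x^{\text{left}}$ and $x^1_1=x^{\text{right}}$, with $x^{\text{left}}<x^{\text{right}}$. Let $x^{\text{high}}_t\in\{x^0_t,x^1_t\}$ be such that $y^{\text{high}}_t=f(x^{\text{high}}_t)=\max\{y^0_t,y^1_t\}$, let $x^{\text{low}}_t$ be the other element of the pair $x^0_t,x^1_t$, and let $y^{\text{low}}_t=f(x^{\text{low}}_t)=\min\{y^0_t,y^1_t\}$. Tangents: $f^i_t(x)=f(x^i_t)+(x-x^i_t)f'(x^i_t)$ for $i\in\{0,1\}$. Optimality region: $$\Delta_t=\{(x,y)\in\mathbb{R}^2 : x\in[x^0_t,x^1_t],\ y\le y^{\text{low}}_t,\ f^0_t(x)\le y,\ f^1_t(x)\le y\}.$$ $\Delta^x_t=\{x : (x,y)\in\Delta_t \text{ for some } y\}$ and $\Delta^y_t=\{y : (x,y)\in\Delta_t\text{ for some }x\}$; these are intervals and $|\cdot|$ denotes their length. Iteration $t$: if $|\Delta^y_t|\le y^{\text{tol}}$ the algorithm stops. Otherwise, with $x^-_t=\inf\Delta^x_t$ and $x^+_t=\sup\Delta^x_t$, it queries $f$ and $f'$ at $x^q_t=\frac12(x^-_t+x^+_t)$ and sets $y^q_t=f(x^q_t)$. If $f'(x^q_t)<0$, then $x^0_{t+1}=x^q_t$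 and $x^1_{t+1}=x^1_t$; otherwise $x^0_{t+1}=x^0_t$ and $x^1_{t+1}=x^q_t$. *)

theory Defs
  imports "HOL-Analysis.Analysis"
begin

text \<open>In all definitions \<open>f\<close> is the objective, \<open>f'\<close> the selected (sub)gradient, and \<open>a\<close>, \<open>b\<close>
  are the two abscissae \<open>x\<^sup>0\<close>, \<open>x\<^sup>1\<close> maintained by the algorithm at the iteration considered.\<close>

text \<open>Both functions are total on the reals; only their values on the set \<open>S\<close> are constrained.
  At a boundary point of \<open>S\<close> the value of \<open>f'\<close> is some subgradient relative to \<open>S\<close>.\<close>

definition subgradient_selection_on ::
  "real set \<Rightarrow> (real \<Rightarrow> real) \<Rightarrow> (real \<Rightarrow> real) \<Rightarrow> bool" where
  "subgradient_selection_on S f f' \<longleftrightarrow>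
     (\<forall>x\<in>S. \<forall>u\<in>S. f u \<ge> f x + (u - x) * f' x)"

definition tangent :: "(real \<Rightarrow> real) \<Rightarrow> (real \<Rightarrow> real) \<Rightarrow> real \<Rightarrow> real \<Rightarrow> real" where
  "tangent f f' p x = f p + (x - p) * f' p"

definition y_low :: "(real \<Rightarrow> real) \<Rightarrow> real \<Rightarrow> real \<Rightarrow> real" where
  "y_low f a b = min (f a) (f b)"

text \<open>A relation rather than a function: if \<open>f a = f b\<close>, either labelling of the pair is allowed.\<close>

definition high_low :: "(real \<Rightarrow> real) \<Rightarrow> real \<Rightarrow> real \<Rightarrow> real \<Rightarrow> real \<Rightarrow> bool" where
  "high_low f a b xhigh xlow \<longleftrightarrow>
     (xhigh = a \<and> xlow = b \<or> xhigh = b \<and> xlow = a) \<and>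
     f xhigh = max (f a) (f b) \<and> f xlow = min (f a) (f b)"

definition Delta ::
  "(real \<Rightarrow> real) \<Rightarrow> (real \<Rightarrow> real) \<Rightarrow> real \<Rightarrow> real \<Rightarrow> (real \<times> real) set" where
  "Delta f f' a b =
     {(x, y). x \<in> {a..b} \<and> y \<le> y_low f a b \<and> tangent f f' a x \<le> y \<and> tangent f f' b x \<le> y}"

definition Delta_x :: "(real \<Rightarrow> real) \<Rightarrow> (real \<Rightarrow> real) \<Rightarrow> real \<Rightarrow> real \<Rightarrow> real set" where
  "Delta_x f f' a b = {x. \<exists>y. (x, y) \<in> Delta f f' a b}"

definition Delta_y :: "(real \<Rightarrow> real) \<Rightarrow> (real \<Rightarrow> real) \<Rightarrow> real \<Rightarrow> real \<Rightarrow> real set" where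
  "Delta_y f f' a b = {y. \<exists>x. (x, y) \<in> Delta f f' a b}"

text \<open>Length of an interval, as its Lebesgue measure.\<close>

abbreviation interval_length :: "real set \<Rightarrow> real" where
  "interval_length \<equiv> measure lborel"

definition x_query :: "(real \<Rightarrow> real) \<Rightarrow> (real \<Rightarrow> real) \<Rightarrow> real \<Rightarrow> real \<Rightarrow> real" where
  "x_query f f' a b = (Inf (Delta_x f f' a b) + Sup (Delta_x f f' a b)) / 2"

text \<open>\<open>delta_bisection f f' xleft xright ytol t a b\<close>: the algorithm reaches iteration \<open>t\<close>
  (iterations are numbered from 1), at which \<open>x\<^sup>0 = a\<close> and \<open>x\<^sup>1 = b\<close>.\<close>

inductive delta_bisection ::
  "(real \<Rightarrow> real) \<Rightarrow> (real \<Rightarrow> real) \<Rightarrow> real \<Rightarrow> real \<Rightarrow> real \<Rightarrow> nat \<Rightarrow> real \<Rightarrow> real \<Rightarrow> bool"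
  for f f' :: "real \<Rightarrow> real" and xleft xright ytol :: real where
  init: "delta_bisection f f' xleft xright ytol 1 xleft xright"
| step_right: "delta_bisection f f' xleft xright ytol (t + 1) (x_query f f' a b) b"
    if "delta_bisection f f' xleft xright ytol t a b"
      and "\<not> interval_length (Delta_y f f' a b) \<le> ytol"
      and "f' (x_query f f' a b) < 0"
| step_left: "delta_bisection f f' xleft xright ytol (t + 1) a (x_query f f' a b)"
    if "delta_bisection f f' xleft xright ytol t a b"
      and "\<not> interval_length (Delta_y f f' a b) \<le> ytol"
      and "\<not> f' (x_query f f' a b) < 0"

end

theory Submission
  imports Defs
begin

text \<open>Write \<open>X p\<close> for the abscissa at which the tangent at \<open>p\<close> meets the level \<open>y_low\<close>. A region of
  positive height forces \<open>f' a < 0 < f' b\<close>, and then \<open>\<Delta>\<^sup>x = [X a, X b]\<close>. Let \<open>q\<close> be the query and \<open>p\<close> the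
  end that is kept. As \<open>q\<close> is the midpoint, \<open>|\<Delta>\<^sup>x\<^sub>t| = 2 |X p - q|\<close>; the discarded end is at least
  as high as \<open>q\<close>. With \<open>h\<close> the higher one of \<open>p\<close> and \<open>q\<close>, both \<open>|\<Delta>\<^sup>x\<^sub>t\<^sub>+\<^sub>1|\<close> and \<open>|X p - q|\<close> are then height
  differences divided by the same slope \<open>|f' h|\<close>.\<close>

text \<open>This is \<open>X p\<close> at an arbitrary level \<open>c\<close>, so that heights below
  \<open>y_low\<close> can be compared with it.\<close>

definition tangent_level :: "(real \<Rightarrow> real) \<Rightarrow> (real \<Rightarrow> real) \<Rightarrow> real \<Rightarrow> real \<Rightarrow> real" where
  "tangent_level f f' c p = p + (c - f p) / f' p"

lemma tangent_level_diff:
  "f' h \<noteq> 0 \<Longrightarrow> tangent_level f f' c h - l = (c - tangent f f' h l) / f' h"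
  by (simp add: tangent_level_def tangent_def field_simps)

lemma tangent_level_self: "tangent_level f f' (f p) p = p"
  by (simp add: tangent_level_def)

lemma tangent_le_iff_neg:
  "f' p < 0 \<Longrightarrow> tangent f f' p x \<le> c \<longleftrightarrow> tangent_level f f' c p \<le> x"
  by (simp add: tangent_level_def tangent_def field_simps)

lemma tangent_le_iff_pos:
  "f' p > 0 \<Longrightarrow> tangent f f' p x \<le> c \<longleftrightarrow> x \<le> tangent_level f f' c p"
  by (simp add: tangent_level_def tangent_def field_simps)

lemma tangent_level_ge_neg: "f' p < 0 \<Longrightarrow> c \<le> f p \<Longrightarrow> p \<le> tangent_level f f' c p"
  by (simp add: tangent_level_def divide_nonpos_neg)

lemma tangent_level_le_pos: "f' p > 0 \<Longrightarrow> c \<le> f p \<Longrightarrow> tangent_level f f' c p \<le> p"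
  by (simp add: tangent_level_def divide_nonpos_pos)

text \<open>A subset of a single point has measure zero, so positive height forces a value other
  than the top one.\<close>

lemma Delta_y_pos_obtains:
  assumes "interval_length (Delta_y f f' a b) > 0"
  obtains x y where "(x, y) \<in> Delta f f' a b" "y < y_low f a b"
proof (cases "Delta_y f f' a b \<subseteq> {y_low f a b}")
  case True
  then have "Delta_y f f' a b = {} \<or> Delta_y f f' a b = {y_low f a b}" by blast
  with assms show ?thesis by auto
next
  case False
  then obtain x y where "(x, y) \<in> Delta f f' a b" "y \<noteq> y_low f a b"
    by (auto simp: Delta_y_def)
  then show ?thesis using that[of x y] by (auto simp: Delta_def)
qed

text \<open>At a point strictly below \<open>y_low\<close> each tangent lies below its contact
  value, which fixes the signs of the slopes. Raising the level from there to \<open>y_low\<close>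
  moves the two crossings strictly apart.\<close>

lemma Delta_y_pos_imp:
  assumes "interval_length (Delta_y f f' a b) > 0"
  shows "f' a < 0" "f' b > 0"
    "tangent_level f f' (y_low f a b) a < tangent_level f f' (y_low f a b) b"
proof -
  obtain x y where xy: "(x, y) \<in> Delta f f' a b" and y: "y < y_low f a b"
    using Delta_y_pos_obtains[OF assms] .
  have ab: "a \<le> x" "x \<le> b" and ta: "tangent f f' a x \<le> y" and tb: "tangent f f' b x \<le> y"
    using xy by (auto simp: Delta_def)
  have fy: "y < f a" "y < f b" using y by (auto simp: y_low_def)
  have "(x - a) * f' a < 0" "(x - b) * f' b < 0"
    using ta tb fy by (auto simp: tangent_def)
  then show neg: "f' a < 0" and pos: "f' b > 0"
    using ab by (auto simp: mult_less_0_iff)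
  let ?c = "y_low f a b"
  have "tangent_level f f' ?c a < tangent_level f f' y a"
    using neg y by (simp add: tangent_level_def divide_strict_right_mono_neg)
  also have "\<dots> \<le> x" using neg ta by (simp add: tangent_le_iff_neg)
  also have "x \<le> tangent_level f f' y b" using pos tb by (simp add: tangent_le_iff_pos)
  also have "\<dots> < tangent_level f f' ?c b"
    using pos y by (simp add: tangent_level_def divide_strict_right_mono)
  finally show "tangent_level f f' ?c a < tangent_level f f' ?c b" .
qed

text \<open>For every \<open>x\<close> the best choice of \<open>y\<close> is \<open>y_low\<close>.
  At that height each tangent cuts out a half-line whose end lies on the inner side of the contact
  point.\<close>

lemma Delta_x_eq:
  assumes "f' a < 0" "f' b > 0"
  shows "Delta_x f f' a b =
    {tangent_level f f' (y_low f a b) a..tangent_level f f' (y_low f a b) b}" (is "_ = {?l..?r}")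
proof -
  have "a \<le> ?l" "?r \<le> b"
    using assms by (auto simp: y_low_def intro!: tangent_level_ge_neg tangent_level_le_pos)
  then have "{?l..?r} \<subseteq> {a..b}" by simp
  moreover have "Delta_x f f' a b = {a..b} \<inter>
      {x. tangent f f' a x \<le> y_low f a b \<and> tangent f f' b x \<le> y_low f a b}"
    unfolding Delta_x_def Delta_def by (auto dest: order_trans)
  moreover have "\<dots> = {a..b} \<inter> {?l..?r}"
    unfolding tangent_le_iff_neg[of f' a, OF assms(1)] tangent_le_iff_pos[of f' b, OF assms(2)] by auto
  ultimately show ?thesis by blast
qed

lemma Delta_y_pos_Delta_x:
  fixes f f' :: "real \<Rightarrow> real" and a b :: real
  defines "l \<equiv> tangent_level f f' (y_low f a b) a" and "r \<equiv> tangent_level f f' (y_low f a b) b"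
  assumes "interval_length (Delta_y f f' a b) > 0"
  shows "interval_length (Delta_x f f' a b) = r - l" "x_query f f' a b = (l + r) / 2"
    "a \<le> l" "l < r" "r \<le> b"
proof -
  note pos = Delta_y_pos_imp[OF assms(3)]
  show "l < r" using pos(3) by (simp add: l_def r_def)
  then show "interval_length (Delta_x f f' a b) = r - l" "x_query f f' a b = (l + r) / 2"
    using pos by (simp_all add: Delta_x_eq x_query_def l_def r_def)
  show "a \<le> l" "r \<le> b"
    using pos unfolding l_def r_def
    by (auto simp: y_low_def intro!: tangent_level_ge_neg tangent_level_le_pos)
qed

text \<open>The tangent at \<open>l\<close> meets the level \<open>f l\<close> at \<open>l\<close>
  itself, so one end of the interval is \<open>l\<close>; the other is found along the tangent at
  \<open>h\<close>.\<close>

lemma high_low_Delta_x_length: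
  assumes "interval_length (Delta_y f f' a b) > 0" and "high_low f a b h l"
  shows "interval_length (Delta_x f f' a b) = \<bar>f l - tangent f f' h l\<bar> / \<bar>f' h\<bar>"
proof -
  let ?X = "tangent_level f f' (f l)"
  note pos = Delta_y_pos_imp[OF assms(1)]
  have low: "y_low f a b = f l" and hl: "h = a \<and> l = b \<or> h = b \<and> l = a"
    using assms(2) by (auto simp: high_low_def y_low_def)
  have "interval_length (Delta_x f f' a b) = \<bar>?X h - ?X l\<bar>"
    using Delta_y_pos_Delta_x(1,4)[OF assms(1)] hl by (auto simp: low)
  also have "\<dots> = \<bar>(f l - tangent f f' h l) / f' h\<bar>"
    using tangent_level_diff[of f' h f "f l" l] pos hl by (auto simp: tangent_level_self)
  finally show ?thesis by (simp add: abs_divide)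
qed

text \<open>Here \<open>d\<close> is the end discarded in favour of the query \<open>q\<close>, and \<open>p\<close> is the end that is kept.\<close>

lemma tangent_level_query_dist:
  assumes "f q \<le> f d" and "f' p \<noteq> 0" and "f' q \<noteq> 0" and "high_low f p q h l"
  shows "\<bar>tangent_level f f' (min (f d) (f p)) p - q\<bar> =
    \<bar>max (f q) (min (f d) (f p)) - tangent f f' h l\<bar> / \<bar>f' h\<bar>"
proof -
  consider "h = q" "l = p" "f p \<le> f q" | "h = p" "l = q" "f q \<le> f p"
    using assms(4) by (auto simp: high_low_def)
  then show ?thesis
  proof cases
    \<comment> \<open>Since \<open>f p \<le> f q \<le> f d\<close>, the level is \<open>f p\<close>,
      so the crossing is \<open>p\<close> and its distance to \<open>q\<close> is measured along the
      tangent at \<open>q\<close>.\<close>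
    case 1
    then have "min (f d) (f p) = f p" "max (f q) (f p) = f q" using assms(1) by auto
    moreover have "tangent_level f f' (f q) q - p = (f q - tangent f f' q p) / f' q"
      using assms(3) by (rule tangent_level_diff)
    ultimately show ?thesis
      using 1 by (simp add: tangent_level_self abs_minus_commute[of p q] flip: abs_divide)
  next
    \<comment> \<open>Now the level is at least \<open>f q\<close>, so the maximum is the level
      itself and the tangent at \<open>p\<close> gives the distance.\<close>
    case 2
    then have "max (f q) (min (f d) (f p)) = min (f d) (f p)" using assms(1) by auto
    then show ?thesis
      using 2 assms(2) by (simp add: tangent_level_diff flip: abs_divide)
  qed
qed

lemma high_low_commute: "high_low f a b h l \<longleftrightarrow> high_low f b a h l"
  by (auto simp: high_low_def max.commute min.commute)

text \<open>The query is the midpoint of an interval inside \<open>{a..b}\<close>, so the brackets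
  stay nested and the subgradient inequality is available at their ends.\<close>

lemma delta_bisection_bounds:
  assumes "delta_bisection f f' xleft xright ytol t a b" and "xleft \<le> xright" and "ytol \<ge> 0"
  shows "xleft \<le> a \<and> a \<le> b \<and> b \<le> xright"
  using assms
proof (induction rule: delta_bisection.induct)
  case (step_right t a b)
  then have "interval_length (Delta_y f f' a b) > 0" by simp
  from Delta_y_pos_Delta_x(2-)[OF this] step_right show ?case by auto
next
  case (step_left t a b)
  then have "interval_length (Delta_y f f' a b) > 0" by simp
  from Delta_y_pos_Delta_x(2-)[OF this] step_left show ?case by auto
qed simp

lemma delta_bisection_pos: "delta_bisection f f' xleft xright ytol t a b \<Longrightarrow> t \<ge> 1"
  by (induction rule: delta_bisection.induct) auto

text \<open>The premise \<open>t \<ge> 1\<close> excludes the rule \<open>init\<close>, which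
  matches \<open>t + 1\<close> at \<open>t = 0\<close>.\<close>

lemma delta_bisection_SucE:
  assumes "delta_bisection f f' xleft xright ytol (t + 1) a' b'" and "t \<ge> 1"
  obtains a b where "delta_bisection f f' xleft xright ytol t a b"
    "interval_length (Delta_y f f' a b) > ytol"
    "f' (x_query f f' a b) < 0 \<and> a' = x_query f f' a b \<and> b' = b \<or>
     f' (x_query f f' a b) \<ge> 0 \<and> a' = a \<and> b' = x_query f f' a b"
  using assms by (cases rule: delta_bisection.cases) (auto simp: not_le not_less)

text \<open>The theorem assumes iterations \<open>t\<close> and \<open>t + 1\<close> separately;
  this makes the first the predecessor of the second.\<close>

lemma delta_bisection_deterministic:
  assumes "delta_bisection f f' xleft xright ytol t a b"
    and "delta_bisection f f' xleft xright ytol t c d"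
  shows "a = c \<and> b = d"
  using assms
proof (induction arbitrary: c d rule: delta_bisection.induct)
  case init
  then show ?case
    by (cases rule: delta_bisection.cases) (auto dest: delta_bisection_pos)
next
  case (step_right t a b)
  from step_right.prems delta_bisection_pos[OF step_right.hyps(1)] show ?case
    by (rule delta_bisection_SucE) (use step_right in \<open>blast dest: leD\<close>)
next
  case (step_left t a b)
  from step_left.prems delta_bisection_pos[OF step_left.hyps(1)] show ?case
    by (rule delta_bisection_SucE) (use step_left in \<open>blast dest: leD\<close>)
qed

theorem theorem1:
  fixes f f' :: "real \<Rightarrow> real" and xleft xright ytol :: real
    and t :: nat and x0 x1 x0' x1' xhigh' xlow' :: real
  assumes "xleft < xright"
    and "convex_on {xleft..xright} f"
    and "subgradient_selection_on {xleft..xright} f f'"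
    and "ytol \<ge> 0"
    and "t \<ge> 2"
    and "delta_bisection f f' xleft xright ytol t x0 x1"
    and "delta_bisection f f' xleft xright ytol (t + 1) x0' x1'"
    and "interval_length (Delta_y f f' x0' x1') > ytol"
    and "high_low f x0' x1' xhigh' xlow'"
  shows "let z = tangent f f' xhigh' xlow';
             yq = f (x_query f f' x0 x1);
             lx = interval_length (Delta_x f f' x0 x1);
             lx' = interval_length (Delta_x f f' x0' x1');
             rhs = 1 / 2 * ((y_low f x0' x1' - z) / (max yq (y_low f x0 x1) - z))
         in lx \<noteq> 0 \<and> max yq (y_low f x0 x1) - z \<noteq> 0 \<and> lx' / lx = rhs \<and> rhs \<le> 1 / 2"
proof -
  let ?q = "x_query f f' x0 x1" and ?c = "y_low f x0 x1"
  define M where "M = max (f ?q) ?c"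
  define z where "z = tangent f f' xhigh' xlow'"
  have S: "f u \<ge> tangent f f' x u" if "x \<in> {xleft..xright}" "u \<in> {xleft..xright}" for x u
    using assms(3) that by (auto simp: subgradient_selection_on_def tangent_def)
  obtain a b where "delta_bisection f f' xleft xright ytol t a b"
    and "interval_length (Delta_y f f' a b) > ytol"
    and "f' (x_query f f' a b) < 0 \<and> x0' = x_query f f' a b \<and> x1' = b \<or>
      f' (x_query f f' a b) \<ge> 0 \<and> x0' = a \<and> x1' = x_query f f' a b"
    using delta_bisection_SucE[OF assms(7)] assms(5) by auto
  moreover from this have "a = x0" "b = x1"
    using delta_bisection_deterministic[OF _ assms(6)] by auto
  ultimately have pos: "interval_length (Delta_y f f' x0 x1) > 0"
    and step: "f' ?q < 0 \<and> x0' = ?q \<and> x1' = x1 \<or> f' ?q \<ge> 0 \<and> x0' = x0 \<and> x1' = ?q"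
    using assms(4) by auto
  have pos': "interval_length (Delta_y f f' x0' x1') > 0" using assms(4,8) by simp
  note slopes = Delta_y_pos_imp[OF pos] and slopes' = Delta_y_pos_imp[OF pos']
  note D = Delta_y_pos_Delta_x[OF pos]
  have bounds: "xleft \<le> x0" "x1 \<le> xright" "xleft \<le> x0'" "x0' \<le> x1'" "x1' \<le> xright"
    using delta_bisection_bounds[OF assms(6)] delta_bisection_bounds[OF assms(7)] assms(1,4)
    by auto
  have q: "x0 < ?q" "?q < x1" using D by auto
  have h: "xhigh' = x0' \<and> xlow' = x1' \<or> xhigh' = x1' \<and> xlow' = x0'"
    and low': "y_low f x0' x1' = f xlow'"
    using assms(9) by (auto simp: high_low_def y_low_def)
  have h0: "\<bar>f' xhigh'\<bar> > 0" using h slopes' by auto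
  have zl: "z \<le> f xlow'" unfolding z_def using bounds h by (intro S) auto
  have lM: "f xlow' \<le> M"
    using assms(9) step by (auto simp: M_def high_low_def)
  have lx: "interval_length (Delta_x f f' x0 x1) = 2 * (\<bar>M - z\<bar> / \<bar>f' xhigh'\<bar>)"
    using step
  proof (elim disjE conjE)
    assume s: "f' ?q < 0" "x0' = ?q" "x1' = x1"
    \<comment> \<open>The tangent at the query does not fall towards the discarded end, and it
      bounds \<open>f\<close> from below there.\<close>
    have "f ?q \<le> tangent f f' ?q x0"
      using s(1) q by (simp add: tangent_def mult_nonpos_nonpos)
    also have "\<dots> \<le> f x0" using q bounds by (intro S) auto
    finally have *: "\<bar>tangent_level f f' ?c x1 - ?q\<bar> = \<bar>M - z\<bar> / \<bar>f' xhigh'\<bar>"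
      unfolding M_def z_def y_low_def using slopes s assms(9)
      by (intro tangent_level_query_dist) (auto simp: high_low_commute)
    show ?thesis unfolding *[symmetric] using D by (simp add: abs_if)
  next
    assume s: "f' ?q \<ge> 0" "x0' = x0" "x1' = ?q"
    have "f ?q \<le> tangent f f' ?q x1"
      using s(1) q by (simp add: tangent_def)
    also have "\<dots> \<le> f x1" using q bounds by (intro S) auto
    \<comment> \<open>The branch only gives \<open>f' ?q \<ge> 0\<close>; the slope is nonzero by
      \<open>slopes'\<close>, as \<open>?q\<close> is the right end of the next region, which has
      positive height.\<close>
    finally have *: "\<bar>tangent_level f f' ?c x0 - ?q\<bar> = \<bar>M - z\<bar> / \<bar>f' xhigh'\<bar>"
      unfolding M_def z_def y_low_def min.commute[of "f x0"] using slopes slopes' s assms(9)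
      by (intro tangent_level_query_dist) auto
    show ?thesis unfolding *[symmetric] using D by (simp add: abs_if)
  qed
  have lx0: "interval_length (Delta_x f f' x0 x1) \<noteq> 0" using D by simp
  \<comment> \<open>The nonzero width gives \<open>M \<noteq> z\<close>, and
    \<open>z \<le> f xlow' \<le> M\<close> then fixes the sign.\<close>
  then have Mz: "M - z > 0" using lx zl lM by auto
  have "interval_length (Delta_x f f' x0' x1') = (f xlow' - z) / \<bar>f' xhigh'\<bar>"
    using high_low_Delta_x_length[OF pos' assms(9)] zl by (simp add: z_def)
  then have "interval_length (Delta_x f f' x0' x1') / interval_length (Delta_x f f' x0 x1) =
      1 / 2 * ((f xlow' - z) / (M - z))"
    using lx Mz h0 by simp
  moreover have "1 / 2 * ((f xlow' - z) / (M - z)) \<le> 1 / 2"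
    using lM Mz by simp
  ultimately show ?thesis
    using lx0 Mz unfolding Let_def low' M_def z_def by simp
qed

end
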